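(* Let $n\ge1$, let $H_n$ be the pyrene system with $n$ pyrene fragments, and let $M$ be a perfect matching of $H_n$. Then there is a non-crossing compatible $M$-alternating set $\mathcal{A}$ of maximum cardinality $c'(M)$ such that each member of $\mathcal{A}$ is either a hexagon of $H_n$ or the periphery of a triphenylene in $H_n$.
   Context: Pyrene system: draw the hexagonal lattice so that every hexagon has two vertical sides; horizontally adjacent hexagons then share a vertical edge. For $n\ge1$, $H_n$ is the hexagonal system (the plane graph formed by the vertices and edges of the following $4n$ hexagons) consisting of a horizontal linear row of $2n$ hexagons $h_{1,1},h_{1,2},h_{2,1},h_{2,2},\dots,h_{n,1},h_{n,2}$, consecutive ones sharing a vertical edge, together with, for each $i=1,\dots,n$, a hexagon $s_{i,1}$ lying directly above and a hexagon $s_{i,2}$ lying directly below the common edge of $h_{i,1}$ and $h_{i,2}$ (each sharing an edge with both $h_{i,1}$ and $h_{i,2}$). For a perfect matching $M$ of a graph $G$, a cycle is $M$-alternating if its edges alternate between $M$ and $E(G)\setminus M$. A set $\mathcal{A}$ of $M$-alternating cycles is compatible if any two of its cycles are either disjoint or intersect only in edges of $M$; $c'(M)$ is the maximum cardinality of a compatible $M$-alternating set. Two cycles $C_1,C_2$ of a compatible set are crossing if they share an edge $f\in M$ and the four edges adjacent to $f$ alternate between $C_1$ and $C_2$ (i.e. $C_1$ enters $C_2$ from one side and leaves to the other side via $f$); $\mathcal{A}$ is non-crossing if no two of its cycles are crossing. A triphenylene is a set of four hexagons consisting of a central hexagon and three pairwise disjoint hexagons each sharing an edge with the central one; its periphery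 is the boundary cycle of their union. *)

theory Defs
  imports Main
begin

text \<open>Hexagonal lattice in brick-wall coordinates. Vertices are integer points (x,y).
  Lattice edges: {(x,y),(x+1,y)} for all x,y, and the vertical edges {(x,y),(x,y+1)}
  for even (x+y). The hexagonal faces are the bricks with lower-left corner (i,j),
  even (i+j); each has two vertical sides (x = i and x = i+2). Horizontally adjacent
  bricks (i,j),(i+2,j) share a vertical edge; brick (i+1,j+1) (resp. (i+1,j-1)) lies
  directly above (resp. below) that common edge and shares an edge with both.\<close>

type_synonym vertex = "int \<times> int"
type_synonym edge = "vertex set"

definition hex_edges :: "int \<times> int \<Rightarrow> edge set" where
  "hex_edges p = (case p of (i, j) \<Rightarrow>
     {{(i,j),(i+1,j)}, {(i+1,j),(i+2,j)},
      {(i,j+1),(i+1,j+1)}, {(i+1,j+1),(i+2,j+1)},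
      {(i,j),(i,j+1)}, {(i+2,j),(i+2,j+1)}})"

definition lattice_hex :: "int \<times> int \<Rightarrow> bool" where
  "lattice_hex p \<longleftrightarrow> even (fst p + snd p)"

text \<open>The 4n hexagons of the pyrene system H_n (for k = 0..n-1):
  h_{k+1,1} = (4k,0), h_{k+1,2} = (4k+2,0), s_{k+1,1} = (4k+1,1), s_{k+1,2} = (4k+1,-1).\<close>

definition pyrene_hexes :: "nat \<Rightarrow> (int \<times> int) set" where
  "pyrene_hexes n = (\<Union>k\<in>{0..<n}.
     {(4 * int k, 0), (4 * int k + 2, 0), (4 * int k + 1, 1), (4 * int k + 1, -1)})"

definition pyrene_edges :: "nat \<Rightarrow> edge set" where
  "pyrene_edges n = (\<Union>h\<in>pyrene_hexes n. hex_edges h)"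

definition pyrene_verts :: "nat \<Rightarrow> vertex set" where
  "pyrene_verts n = \<Union>(pyrene_edges n)"

definition perfect_matching :: "vertex set \<Rightarrow> edge set \<Rightarrow> edge set \<Rightarrow> bool" where
  "perfect_matching V E M \<longleftrightarrow> M \<subseteq> E \<and> (\<forall>v\<in>V. \<exists>!e. e \<in> M \<and> v \<in> e)"

text \<open>A cycle, given by its (finite, nonempty) edge set: every vertex on it has degree 2
  and it is connected.\<close>

definition cycle_adj :: "edge set \<Rightarrow> (vertex \<times> vertex) set" where
  "cycle_adj C = {(x, y). {x, y} \<in> C}"

definition is_cycle :: "edge set \<Rightarrow> edge set \<Rightarrow> bool" where
  "is_cycle E C \<longleftrightarrow> C \<subseteq> E \<and> finite C \<and> C \<noteq> {} \<and>
     (\<forall>e\<in>C. \<exists>u v. u \<noteq> v \<and> e = {u, v}) \<and>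
     (\<forall>x\<in>\<Union>C. card {e\<in>C. x \<in> e} = 2) \<and>
     (\<forall>x\<in>\<Union>C. \<forall>y\<in>\<Union>C. (x, y) \<in> (cycle_adj C)\<^sup>*)"

text \<open>M-alternating: consecutive edges (those sharing a vertex) alternate between M and
  E - M, i.e. at every vertex of the cycle exactly one of its two cycle edges is in M.\<close>

definition alternating_cycle :: "edge set \<Rightarrow> edge set \<Rightarrow> edge set \<Rightarrow> bool" where
  "alternating_cycle E M C \<longleftrightarrow> is_cycle E C \<and>
     (\<forall>x\<in>\<Union>C. card {e\<in>C \<inter> M. x \<in> e} = 1)"

text \<open>Two cycles are disjoint or intersect only in edges of M: every common edge is in M
  and every common vertex lies on a common edge.\<close>

definition compatible_pair :: "edge set \<Rightarrow> edge set \<Rightarrow> edge set \<Rightarrow> bool" where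
  "compatible_pair M C1 C2 \<longleftrightarrow> C1 \<inter> C2 \<subseteq> M \<and>
     (\<forall>x \<in> \<Union>C1 \<inter> \<Union>C2. \<exists>e\<in>C1 \<inter> C2. x \<in> e)"

definition compatible_alt_set :: "edge set \<Rightarrow> edge set \<Rightarrow> edge set set \<Rightarrow> bool" where
  "compatible_alt_set E M \<A> \<longleftrightarrow> (\<forall>C\<in>\<A>. alternating_cycle E M C) \<and>
     (\<forall>C1\<in>\<A>. \<forall>C2\<in>\<A>. C1 \<noteq> C2 \<longrightarrow> compatible_pair M C1 C2)"

definition c_prime :: "edge set \<Rightarrow> edge set \<Rightarrow> nat" where
  "c_prime E M = Max {card \<A> | \<A>. compatible_alt_set E M \<A>}"

text \<open>Sides of an edge f in the planar hexagonal lattice: two edges a, b incident with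
  the two ends of f lie on the same side of f iff a, f, b lie on a common hexagonal
  face of the lattice.\<close>

definition same_side :: "edge \<Rightarrow> edge \<Rightarrow> edge \<Rightarrow> bool" where
  "same_side f a b \<longleftrightarrow> (\<exists>p. lattice_hex p \<and> {f, a, b} \<subseteq> hex_edges p)"

text \<open>C1 and C2 cross at f \<in> M: the four edges adjacent to f alternate between C1 and C2,
  i.e. C1 (and likewise C2) uses edges on opposite sides of f at the two ends of f.\<close>

definition crossing :: "edge set \<Rightarrow> edge set \<Rightarrow> edge set \<Rightarrow> bool" where
  "crossing M C1 C2 \<longleftrightarrow> (\<exists>f \<in> C1 \<inter> C2 \<inter> M.
     (\<exists>a\<in>C1. \<exists>b\<in>C1. a \<noteq> f \<and> b \<noteq> f \<and> a \<noteq> b \<and> a \<inter> f \<noteq> {} \<and> b \<inter> f \<noteq> {} \<and>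
        \<not> same_side f a b) \<and>
     (\<exists>a\<in>C2. \<exists>b\<in>C2. a \<noteq> f \<and> b \<noteq> f \<and> a \<noteq> b \<and> a \<inter> f \<noteq> {} \<and> b \<inter> f \<noteq> {} \<and>
        \<not> same_side f a b))"

definition non_crossing :: "edge set \<Rightarrow> edge set set \<Rightarrow> bool" where
  "non_crossing M \<A> \<longleftrightarrow> (\<forall>C1\<in>\<A>. \<forall>C2\<in>\<A>. C1 \<noteq> C2 \<longrightarrow> \<not> crossing M C1 C2)"

text \<open>A triphenylene among a set S of hexagons: central hexagon c and three pairwise
  (vertex-)disjoint hexagons each sharing an edge with c. Its periphery is the boundary
  of the union: the edges lying on exactly one of the four hexagons.\<close>

definition hex_verts :: "int \<times> int \<Rightarrow> vertex set" where
  "hex_verts p = \<Union>(hex_edges p)"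

definition triphenylene :: "(int \<times> int) set \<Rightarrow> (int \<times> int) set \<Rightarrow> bool" where
  "triphenylene S T \<longleftrightarrow> T \<subseteq> S \<and> (\<exists>c h1 h2 h3. T = {c, h1, h2, h3} \<and>
     hex_verts h1 \<inter> hex_verts h2 = {} \<and> hex_verts h1 \<inter> hex_verts h3 = {} \<and>
     hex_verts h2 \<inter> hex_verts h3 = {} \<and>
     hex_edges c \<inter> hex_edges h1 \<noteq> {} \<and> hex_edges c \<inter> hex_edges h2 \<noteq> {} \<and>
     hex_edges c \<inter> hex_edges h3 \<noteq> {})"

definition periphery :: "(int \<times> int) set \<Rightarrow> edge set" where
  "periphery T = {e. card {h\<in>T. e \<in> hex_edges h} = 1}"

end

theory Submission
  imports Defs
begin

text \<open>
  Distinct cycles of a compatible set share no edge outside \<open>M\<close>. Hence a set \<open>S\<close> of edges outside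
  \<open>M\<close> that meets every \<open>M\<close>-alternating cycle bounds the size of every compatible set, and it is
  enough to exhibit such an \<open>S\<close> together with a compatible set of the same size made of hexagons
  and triphenylene peripheries.

  In each pyrene fragment \<open>M\<close> has one of six shapes: either its middle vertical edge is in \<open>M\<close>, and
  \<open>M\<close> reaches out to both vertices of the left or of the right boundary edge (an open fragment), or
  the two outer hexagons are both alternating, with \<open>M\<close> oriented to the same side (a closed fragment)
  or to opposite sides (a skew fragment). An open fragment contributes one cycle, a skew fragment two
  and a closed fragment three. The third cycle of a closed fragment is a hexagon of the row,
  except when the neighbouring fragment is open towards it; then that hexagon is not alternating and a
  triphenylene takes its place. The same numbers of edges, cut in every fragment, destroy
  all alternating cycles: the graph whose arcs are the edges of \<open>M\<close>, directed from black to white, and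
  the remaining edges outside \<open>M\<close>, directed from white to black, has a strictly increasing
  potential.
\<close>

section \<open>Compatible sets and alternating cycles\<close>

lemma c_prime_eq_card_if_hitting_set:
  assumes "compatible_alt_set E M \<A>" "finite S" "S \<inter> M = {}" "card S \<le> card \<A>"
    and hit: "\<And>C. alternating_cycle E M C \<Longrightarrow> C \<inter> S \<noteq> {}"
  shows "c_prime E M = card \<A>"
proof -
  have bound: "card \<B> \<le> card \<A>" if \<B>: "compatible_alt_set E M \<B>" for \<B>
  proof -
    define g where "g C = (SOME e. e \<in> C \<inter> S)" for C
    have g: "g C \<in> C \<inter> S" if "C \<in> \<B>" for C
    proof -
      have "C \<inter> S \<noteq> {}" using hit \<B> that unfolding compatible_alt_set_def by blast
      then show ?thesis unfolding g_def using someI_ex[of "\<lambda>e. e \<in> C \<inter> S"] by blast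
    qed
    have "inj_on g \<B>"
    proof (rule inj_onI, rule ccontr)
      fix C D assume "C \<in> \<B>" "D \<in> \<B>" "g C = g D" "C \<noteq> D"
      moreover from this have "C \<inter> D \<subseteq> M"
        using \<B> unfolding compatible_alt_set_def compatible_pair_def by blast
      ultimately have "g C \<in> M" using g[of C] g[of D] by auto
      then show False using g[OF \<open>C \<in> \<B>\<close>] assms(3) by auto
    qed
    then have "card \<B> \<le> card S"
      using g by (intro card_inj_on_le[of g]) (auto simp: assms(2))
    then show ?thesis using assms(4) by simp
  qed
  then have "{card \<B> |\<B>. compatible_alt_set E M \<B>} \<subseteq> {..card \<A>}" by blast
  then show ?thesis
    unfolding c_prime_def using bound assms(1)
    by (intro Max_eqI) (blast intro: finite_subset)+
qed

lemma compatible_pair_if_Int_subset: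
  assumes M: "perfect_matching (\<Union>E) E M"
    and C: "alternating_cycle E M C" and D: "alternating_cycle E M D" and sub: "C \<inter> D \<subseteq> M"
  shows "compatible_pair M C D"
  unfolding compatible_pair_def
proof (intro conjI ballI sub)
  fix x assume x: "x \<in> \<Union>C \<inter> \<Union>D"
  have ex: "\<exists>e \<in> K \<inter> M. x \<in> e" if "alternating_cycle E M K" "x \<in> \<Union>K" for K
  proof -
    have "card {e \<in> K \<inter> M. x \<in> e} = 1" using that unfolding alternating_cycle_def by blast
    then show ?thesis by (metis (no_types, lifting) card_1_singletonE mem_Collect_eq singletonI)
  qed
  obtain e where e: "e \<in> C \<inter> M" "x \<in> e" using ex C x by blast
  obtain e' where e': "e' \<in> D \<inter> M" "x \<in> e'" using ex D x by blast
  have "x \<in> \<Union>E" using C x unfolding alternating_cycle_def is_cycle_def by blast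
  then have "e = e'" using M e e' unfolding perfect_matching_def by blast
  then show "\<exists>e \<in> C \<inter> D. x \<in> e" using e e' by blast
qed

lemma alternating_cycle_hits_if_potential:
  fixes \<phi> :: "vertex \<Rightarrow> int"
  assumes C: "alternating_cycle E M C"
    and black: "\<And>v e. e \<in> E \<Longrightarrow> e \<in> M \<Longrightarrow> v \<in> e \<Longrightarrow> black v \<Longrightarrow> \<exists>w\<in>e. \<phi> v < \<phi> w"
    and white: "\<And>v e. e \<in> E \<Longrightarrow> e \<notin> M \<Longrightarrow> e \<notin> S \<Longrightarrow> v \<in> e \<Longrightarrow> \<not> black v \<Longrightarrow> \<exists>w\<in>e. \<phi> v < \<phi> w"
  shows "C \<inter> S \<noteq> {}"
proof
  assume CS: "C \<inter> S = {}"
  have "is_cycle E C" using C unfolding alternating_cycle_def by blast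
  then have slot_cycle: "C \<subseteq> E" "finite C" "C \<noteq> {}" "\<And>e. e \<in> C \<Longrightarrow> \<exists>u v. u \<noteq> v \<and> e = {u, v}"
    "\<And>x. x \<in> \<Union>C \<Longrightarrow> card {e \<in> C. x \<in> e} = 2"
    unfolding is_cycle_def by blast+
  have "finite e" "e \<noteq> {}" if "e \<in> C" for e using slot_cycle(4)[OF that] by auto
  then have fin: "finite (\<phi> ` \<Union>C)" and "\<phi> ` \<Union>C \<noteq> {}" using slot_cycle(2,3) by auto
  then have "Max (\<phi> ` \<Union>C) \<in> \<phi> ` \<Union>C" by (rule Max_in)
  then obtain v where v: "v \<in> \<Union>C" "\<phi> v = Max (\<phi> ` \<Union>C)" by (metis imageE)
  have max: "\<not> \<phi> v < \<phi> w" if "e \<in> C" "w \<in> e" for e w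
    unfolding v(2) not_less using that by (intro Max_ge fin) blast
  have one: "card {e \<in> C \<inter> M. v \<in> e} = 1" using C v(1) unfolding alternating_cycle_def by blast
  then obtain e where e: "{e \<in> C \<inter> M. v \<in> e} = {e}" using card_1_singletonE by blast
  have "\<exists>e'\<in>C. v \<in> e' \<and> e' \<notin> M"
  proof (rule ccontr)
    assume "\<not> ?thesis"
    then have "{e \<in> C. v \<in> e} = {e \<in> C \<inter> M. v \<in> e}" by blast
    then show False using slot_cycle(5)[OF v(1)] one by simp
  qed
  then obtain e' where e': "e' \<in> C" "v \<in> e'" "e' \<notin> M" by blast
  show False
  proof (cases "black v")
    case True
    moreover have "e \<in> C" "e \<in> M" "v \<in> e" using e by blast+
    ultimately show ?thesis using black[of e v] max slot_cycle(1) by blast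
  next
    case False
    then show ?thesis using white[of e' v] e' max slot_cycle(1) CS by blast
  qed
qed

definition walk_edges :: "vertex list \<Rightarrow> edge list" where
  "walk_edges vs = map2 (\<lambda>u v. {u, v}) vs (rotate1 vs)"

lemma length_walk_edges [simp]: "length (walk_edges vs) = length vs"
  by (simp add: walk_edges_def)

lemma nth_walk_edges:
  "i < length vs \<Longrightarrow> walk_edges vs ! i = {vs ! i, vs ! (Suc i mod length vs)}"
  by (simp add: walk_edges_def nth_rotate1)

lemma walk_edges_at_vertex:
  assumes vs: "distinct vs" "length vs \<ge> 3" and i: "i < length vs"
  shows "{e \<in> set (walk_edges vs). vs ! (Suc i mod length vs) \<in> e} =
      {walk_edges vs ! i, walk_edges vs ! (Suc i mod length vs)}"
    and "walk_edges vs ! i \<noteq> walk_edges vs ! (Suc i mod length vs)"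
proof -
  let ?N = "length vs" and ?s = "\<lambda>i. Suc i mod length vs"
  have N: "?N > 0" using vs(2) by linarith
  have s: "?s j < ?N" for j using N by simp
  have nth: "vs ! a = vs ! b \<longleftrightarrow> a = b" if "a < ?N" "b < ?N" for a b
    using nth_eq_iff_index_eq vs(1) that by blast
  have s_val: "?s j = (if Suc j = ?N then 0 else Suc j)" if "j < ?N" for j
    using that by auto
  have s_inj: "?s a = ?s b \<longleftrightarrow> a = b" if "a < ?N" "b < ?N" for a b
    using that by (auto simp: s_val split: if_splits)
  have "vs ! ?s i \<in> walk_edges vs ! j \<longleftrightarrow> j = i \<or> j = ?s i" if "j < ?N" for j
    using that i s nth s_inj by (auto simp: nth_walk_edges)
  then show "{e \<in> set (walk_edges vs). vs ! ?s i \<in> e} = {walk_edges vs ! i, walk_edges vs ! ?s i}"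
    using i s by (auto simp: in_set_conv_nth)
  have "?s (?s i) \<noteq> i" "?s i \<noteq> i"
    using i vs(2) by (auto simp: s_val s split: if_splits)
  then show "walk_edges vs ! i \<noteq> walk_edges vs ! ?s i"
    using i s nth by (simp add: nth_walk_edges doubleton_eq_iff)
qed

lemma alternating_cycle_walk_edges:
  assumes vs: "distinct vs" "length vs \<ge> 3"
    and E: "set (walk_edges vs) \<subseteq> E"
    and alt: "list_all2 (\<lambda>e e'. (e \<in> M) \<noteq> (e' \<in> M)) (walk_edges vs) (rotate1 (walk_edges vs))"
  shows "alternating_cycle E M (set (walk_edges vs))"
proof -
  let ?N = "length vs" and ?s = "\<lambda>i. Suc i mod length vs" and ?C = "set (walk_edges vs)"
  have N: "?N > 0" using vs(2) by linarith
  have s: "?s j < ?N" for j using N by simp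
  have Union: "\<Union>?C = set vs"
  proof
    have "walk_edges vs ! i \<subseteq> set vs" if "i < ?N" for i
      using s that by (simp add: nth_walk_edges)
    then show "\<Union>?C \<subseteq> set vs" by (metis Sup_least in_set_conv_nth length_walk_edges)
    show "set vs \<subseteq> \<Union>?C"
    proof
      fix x assume "x \<in> set vs"
      then obtain i where "i < ?N" "x = vs ! i" by (auto simp: in_set_conv_nth)
      then have "walk_edges vs ! i \<in> ?C" "x \<in> walk_edges vs ! i"
        by (simp, simp add: nth_walk_edges)
      then show "x \<in> \<Union>?C" by blast
    qed
  qed
  have vertex: "\<exists>i<?N. x = vs ! ?s i" if x: "x \<in> set vs" for x
  proof -
    obtain j where j: "j < ?N" "x = vs ! j" using x by (auto simp: in_set_conv_nth)
    show ?thesis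
    proof (cases j)
      case 0
      then show ?thesis using j N by (intro exI[of _ "?N - 1"]) auto
    next
      case (Suc i)
      then show ?thesis using j by (intro exI[of _ i]) auto
    qed
  qed
  have conn: "(vs ! 0, vs ! i) \<in> (cycle_adj ?C)\<^sup>*" if "i < ?N" for i
    using that
  proof (induction i)
    case (Suc i)
    then have "walk_edges vs ! i = {vs ! i, vs ! Suc i}" by (simp add: nth_walk_edges)
    then have "(vs ! i, vs ! Suc i) \<in> cycle_adj ?C"
      using Suc.prems nth_mem[of i "walk_edges vs"] by (simp add: cycle_adj_def)
    then show ?case using Suc by (meson Suc_lessD rtrancl.rtrancl_into_rtrancl)
  qed simp
  have "sym (cycle_adj ?C)" by (auto simp: sym_def cycle_adj_def insert_commute)
  then have "sym ((cycle_adj ?C)\<^sup>*)" by (rule sym_rtrancl)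
  then have "\<forall>x\<in>\<Union>?C. \<forall>y\<in>\<Union>?C. (x, y) \<in> (cycle_adj ?C)\<^sup>*"
    using conn unfolding Union by (metis (no_types, lifting) in_set_conv_nth rtrancl_trans symD)
  moreover have "\<forall>e\<in>?C. \<exists>u v. u \<noteq> v \<and> e = {u, v}"
  proof
    fix e assume "e \<in> ?C"
    then obtain i where i: "i < ?N" "e = {vs ! i, vs ! ?s i}"
      by (auto simp: in_set_conv_nth nth_walk_edges)
    then have "?s i \<noteq> i" using vs(2) by (cases "Suc i = ?N") auto
    then have "vs ! i \<noteq> vs ! ?s i" using i s vs(1) by (simp add: nth_eq_iff_index_eq)
    then show "\<exists>u v. u \<noteq> v \<and> e = {u, v}" using i by blast
  qed
  moreover have "card {e \<in> ?C. x \<in> e} = 2 \<and> card {e \<in> ?C \<inter> M. x \<in> e} = 1" if x: "x \<in> \<Union>?C" for x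
  proof -
    obtain i where i: "i < ?N" "x = vs ! ?s i" using vertex x Union by blast
    note at = walk_edges_at_vertex[OF vs i(1)]
    let ?a = "walk_edges vs ! i" and ?b = "walk_edges vs ! ?s i"
    have "(?a \<in> M) \<noteq> (?b \<in> M)"
      using alt i(1) unfolding list_all2_conv_all_nth by (auto simp: nth_rotate1)
    then have one: "{?a, ?b} \<inter> M = {?a} \<or> {?a, ?b} \<inter> M = {?b}" by blast
    have eq: "{e \<in> ?C. x \<in> e} = {?a, ?b}" using at(1) i(2) by simp
    then have eqM: "{e \<in> ?C \<inter> M. x \<in> e} = {?a, ?b} \<inter> M" by blast
    have "card ({?a, ?b} \<inter> M) = 1" using one by (rule disjE) simp_all
    moreover have "card {?a, ?b} = 2" using at(2) by simp
    ultimately show ?thesis unfolding eq eqM by simp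
  qed
  moreover have "?C \<noteq> {}" using N by (metis length_0_conv length_walk_edges less_irrefl set_empty)
  ultimately show ?thesis
    unfolding alternating_cycle_def is_cycle_def using E by blast
qed

section \<open>Hexagons, triphenylenes and the edges of the pyrene system\<close>

definition hz :: "int \<Rightarrow> int \<Rightarrow> edge" where "hz x y = {(x, y), (x + 1, y)}"
definition vt :: "int \<Rightarrow> int \<Rightarrow> edge" where "vt x y = {(x, y), (x, y + 1)}"

lemma hz_vt_inject [simp]:
  "hz x y = hz x' y' \<longleftrightarrow> x = x' \<and> y = y'"
  "vt x y = vt x' y' \<longleftrightarrow> x = x' \<and> y = y'"
  "hz x y \<noteq> vt x' y'" "vt x' y' \<noteq> hz x y"
  by (auto simp: hz_def vt_def doubleton_eq_iff)

lemma hex_edges_eq: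
  "hex_edges (i, j) = {hz i j, hz (i+1) j, hz i (j+1), hz (i+1) (j+1), vt i j, vt (i+2) j}"
  by (simp add: hex_edges_def hz_def vt_def add.assoc)

lemma mem_pyrene_edges:
  "e \<in> pyrene_edges n \<longleftrightarrow> (\<exists>k. 0 \<le> k \<and> k < int n \<and>
     (e \<in> hex_edges (4*k, 0) \<or> e \<in> hex_edges (4*k+2, 0) \<or>
      e \<in> hex_edges (4*k+1, 1) \<or> e \<in> hex_edges (4*k+1, -1)))" (is "?l \<longleftrightarrow> ?r")
proof
  show "?l \<Longrightarrow> ?r" unfolding pyrene_edges_def pyrene_hexes_def
    by (auto intro: exI[of _ "int _"])
  assume ?r
  then obtain k where k: "0 \<le> k" "k < int n" and e: "e \<in> hex_edges (4*k, 0) \<or> e \<in> hex_edges (4*k+2, 0) \<or>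
      e \<in> hex_edges (4*k+1, 1) \<or> e \<in> hex_edges (4*k+1, -1)" by blast
  then show ?l unfolding pyrene_edges_def pyrene_hexes_def
    by (auto intro!: bexI[of _ "nat k"])
qed

lemma mod_4_cases: "\<exists>q. x = 4*q \<or> x = 4*q + 1 \<or> x = 4*q + 2 \<or> x = 4*q + 3" for x :: int
  by presburger

lemma hz_mem_pyrene_edges:
  "hz x y \<in> pyrene_edges n \<longleftrightarrow> 0 \<le> x \<and> x < 4 * int n \<and>
     (y = 0 \<or> y = 1 \<or> (y = 2 \<or> y = -1) \<and> (x mod 4 = 1 \<or> x mod 4 = 2))" (is "?l \<longleftrightarrow> ?r")
proof
  assume ?l
  then show ?r unfolding mem_pyrene_edges hex_edges_eq
    by auto
next
  assume r: ?r
  obtain q where "x = 4*q \<or> x = 4*q + 1 \<or> x = 4*q + 2 \<or> x = 4*q + 3"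
    using mod_4_cases by blast
  with r show ?l unfolding mem_pyrene_edges hex_edges_eq
    by (intro exI[of _ q]) (elim disjE, auto)
qed

lemma vt_mem_pyrene_edges:
  "vt x y \<in> pyrene_edges n \<longleftrightarrow> 0 \<le> x \<and> n \<ge> 1 \<and>
     (y = 0 \<and> even x \<and> x \<le> 4 * int n \<or>
      (y = 1 \<or> y = -1) \<and> x < 4 * int n \<and> (x mod 4 = 1 \<or> x mod 4 = 3))" (is "?l \<longleftrightarrow> ?r")
proof
  assume ?l
  then show ?r unfolding mem_pyrene_edges hex_edges_eq
    by auto
next
  assume r: ?r
  show ?l
  proof (cases "x = 4 * int n")
    case True
    then show ?thesis using r unfolding mem_pyrene_edges hex_edges_eq
      by (intro exI[of _ "int n - 1"]) auto
  next
    case False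
    obtain q where "x = 4*q \<or> x = 4*q + 1 \<or> x = 4*q + 2 \<or> x = 4*q + 3"
      using mod_4_cases by blast
    with r False show ?thesis unfolding mem_pyrene_edges hex_edges_eq
      by (intro exI[of _ q]) (elim disjE, auto)
  qed
qed

lemma pyrene_edge_cases:
  assumes "e \<in> pyrene_edges n"
  obtains x y where "e = hz x y" | x y where "e = vt x y"
  using assms unfolding mem_pyrene_edges hex_edges_eq by blast

text \<open>The peripheries of the two triphenylenes with a row hexagon as centre: \<open>tri_left i\<close> has its centre
  at \<open>(i + 2, 0)\<close> and its row neighbour to the left, \<open>tri_right i\<close> has its centre at \<open>(i + 1, 0)\<close> and its
  row neighbour to the right.\<close>

definition tri_left :: "int \<Rightarrow> edge list" where
  "tri_left i = [hz i 0, hz (i+1) 0, hz (i+2) 0, vt (i+3) (-1), hz (i+3) (-1), hz (i+4) (-1),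
     vt (i+5) (-1), hz (i+4) 0, vt (i+4) 0, hz (i+4) 1, vt (i+5) 1, hz (i+4) 2, hz (i+3) 2,
     vt (i+3) 1, hz (i+2) 1, hz (i+1) 1, hz i 1, vt i 0]"

definition tri_right :: "int \<Rightarrow> edge list" where
  "tri_right i = [vt i (-1), hz i (-1), hz (i+1) (-1), vt (i+2) (-1), hz (i+2) 0, hz (i+3) 0,
     hz (i+4) 0, vt (i+5) 0, hz (i+4) 1, hz (i+3) 1, hz (i+2) 1, vt (i+2) 1, hz (i+1) 2,
     hz i 2, vt i 1, hz i 1, vt (i+1) 0, hz i 0]"

lemma tri_left_eq_walk_edges:
  "tri_left i = walk_edges [(i,0),(i+1,0),(i+2,0),(i+3,0),(i+3,-1),(i+4,-1),(i+5,-1),(i+5,0),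
     (i+4,0),(i+4,1),(i+5,1),(i+5,2),(i+4,2),(i+3,2),(i+3,1),(i+2,1),(i+1,1),(i,1)]"
  by (simp add: tri_left_def walk_edges_def hz_def vt_def doubleton_eq_iff)

lemma tri_right_eq_walk_edges:
  "tri_right i = walk_edges [(i,0),(i,-1),(i+1,-1),(i+2,-1),(i+2,0),(i+3,0),(i+4,0),(i+5,0),
     (i+5,1),(i+4,1),(i+3,1),(i+2,1),(i+2,2),(i+1,2),(i,2),(i,1),(i+1,1),(i+1,0)]"
  by (simp add: tri_right_def walk_edges_def hz_def vt_def doubleton_eq_iff)

abbreviation alternates :: "edge set \<Rightarrow> edge list \<Rightarrow> bool" where
  "alternates M es \<equiv> list_all2 (\<lambda>e e'. (e \<in> M) \<noteq> (e' \<in> M)) es (rotate1 es)"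

lemma alternating_cycle_tri_left:
  "set (tri_left i) \<subseteq> E \<Longrightarrow> alternates M (tri_left i) \<Longrightarrow> alternating_cycle E M (set (tri_left i))"
  unfolding tri_left_eq_walk_edges by (rule alternating_cycle_walk_edges) auto

lemma alternating_cycle_tri_right:
  "set (tri_right i) \<subseteq> E \<Longrightarrow> alternates M (tri_right i) \<Longrightarrow> alternating_cycle E M (set (tri_right i))"
  unfolding tri_right_eq_walk_edges by (rule alternating_cycle_walk_edges) auto

definition hex_walk :: "int \<Rightarrow> int \<Rightarrow> edge list" where
  "hex_walk i j = [hz i j, hz (i+1) j, vt (i+2) j, hz (i+1) (j+1), hz i (j+1), vt i j]"

lemma set_hex_walk: "set (hex_walk i j) = hex_edges (i, j)"
  by (simp add: hex_walk_def hex_edges_eq insert_commute)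

lemma hex_walk_eq_walk_edges:
  "hex_walk i j = walk_edges [(i,j),(i+1,j),(i+2,j),(i+2,j+1),(i+1,j+1),(i,j+1)]"
  by (simp add: hex_walk_def walk_edges_def hz_def vt_def doubleton_eq_iff)

lemma alternating_cycle_hex:
  "hex_edges (i, j) \<subseteq> E \<Longrightarrow> alternates M (hex_walk i j) \<Longrightarrow> alternating_cycle E M (hex_edges (i, j))"
  unfolding set_hex_walk[symmetric] hex_walk_eq_walk_edges by (rule alternating_cycle_walk_edges) auto

lemma card_filter_4:
  assumes "distinct [a, b, c, d]"
  shows "card {h \<in> {a, b, c, d}. P h} = of_bool (P a) + of_bool (P b) + of_bool (P c) + of_bool (P d)"
proof -
  have "card {h \<in> {a, b, c, d}. P h} = (\<Sum>h\<in>{a, b, c, d}. of_bool (P h))"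
    by (simp add: Int_def)
  then show ?thesis using assms by simp
qed

lemma periphery_tri_left:
  "periphery {(i+2,0), (i,0), (i+3,1), (i+3,-1)} = set (tri_left i)"
proof -
  let ?T = "{(i+2,0), (i,0), (i+3,1), (i+3,-1)}"
  have "(card {h \<in> ?T. e \<in> hex_edges h} = 1) = (e \<in> set (tri_left i))" for e
  proof (cases "e \<in> \<Union>(hex_edges ` ?T)")
    case True
    then have e: "e \<in> hex_edges (i+2,0) \<union> hex_edges (i,0) \<union> hex_edges (i+3,1) \<union> hex_edges (i+3,-1)" by blast
    have card: "card {h \<in> ?T. e \<in> hex_edges h} = of_bool (e \<in> hex_edges (i+2,0)) + of_bool (e \<in> hex_edges (i,0))
        + of_bool (e \<in> hex_edges (i+3,1)) + of_bool (e \<in> hex_edges (i+3,-1))"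
      by (rule card_filter_4) simp
    show ?thesis
      using e unfolding card unfolding hex_edges_eq Un_iff insert_iff empty_iff
      by (elim disjE FalseE; hypsubst; simp add: tri_left_def)
  next
    case False
    then have empty: "{h \<in> ?T. e \<in> hex_edges h} = {}" by blast
    have "set (tri_left i) \<subseteq> \<Union>(hex_edges ` ?T)" by (simp add: hex_edges_eq tri_left_def)
    then have "e \<notin> set (tri_left i)" using False by blast
    then show ?thesis unfolding empty by simp
  qed
  then show ?thesis unfolding periphery_def by blast
qed

lemma periphery_tri_right:
  "periphery {(i+1,0), (i+3,0), (i,1), (i,-1)} = set (tri_right i)"
proof -
  let ?T = "{(i+1,0), (i+3,0), (i,1), (i,-1)}"
  have "(card {h \<in> ?T. e \<in> hex_edges h} = 1) = (e \<in> set (tri_right i))" for e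
  proof (cases "e \<in> \<Union>(hex_edges ` ?T)")
    case True
    then have e: "e \<in> hex_edges (i+1,0) \<union> hex_edges (i+3,0) \<union> hex_edges (i,1) \<union> hex_edges (i,-1)" by blast
    have card: "card {h \<in> ?T. e \<in> hex_edges h} = of_bool (e \<in> hex_edges (i+1,0)) + of_bool (e \<in> hex_edges (i+3,0))
        + of_bool (e \<in> hex_edges (i,1)) + of_bool (e \<in> hex_edges (i,-1))"
      by (rule card_filter_4) simp
    show ?thesis
      using e unfolding card unfolding hex_edges_eq Un_iff insert_iff empty_iff
      by (elim disjE FalseE; hypsubst; simp add: tri_right_def)
  next
    case False
    then have empty: "{h \<in> ?T. e \<in> hex_edges h} = {}" by blast
    have "set (tri_right i) \<subseteq> \<Union>(hex_edges ` ?T)" by (simp add: hex_edges_eq tri_right_def)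
    then have "e \<notin> set (tri_right i)" using False by blast
    then show ?thesis unfolding empty by simp
  qed
  then show ?thesis unfolding periphery_def by blast
qed

lemma hex_verts_eq:
  "hex_verts (i, j) = {(i,j), (i+1,j), (i+2,j), (i,j+1), (i+1,j+1), (i+2,j+1)}"
  by (auto simp: hex_verts_def hex_edges_def)

lemma triphenylene_left:
  assumes "{(i+2,0), (i,0), (i+3,1), (i+3,-1)} \<subseteq> S"
  shows "triphenylene S {(i+2,0), (i,0), (i+3,1), (i+3,-1)}"
proof -
  have "vt (i+2) 0 \<in> hex_edges (i+2, 0) \<inter> hex_edges (i, 0)"
    "hz (i+3) 1 \<in> hex_edges (i+2, 0) \<inter> hex_edges (i+3, 1)"
    "hz (i+3) 0 \<in> hex_edges (i+2, 0) \<inter> hex_edges (i+3, -1)"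
    by (auto simp: hex_edges_eq)
  then have "hex_edges (i+2,0) \<inter> hex_edges (i,0) \<noteq> {}" "hex_edges (i+2,0) \<inter> hex_edges (i+3,1) \<noteq> {}"
    "hex_edges (i+2,0) \<inter> hex_edges (i+3,-1) \<noteq> {}" by blast+
  moreover have "hex_verts (i,0) \<inter> hex_verts (i+3,1) = {}" "hex_verts (i,0) \<inter> hex_verts (i+3,-1) = {}"
    "hex_verts (i+3,1) \<inter> hex_verts (i+3,-1) = {}" by (simp_all add: hex_verts_eq)
  ultimately show ?thesis using assms unfolding triphenylene_def
    by (intro conjI exI[of _ "(i+2,0)"] exI[of _ "(i,0)"] exI[of _ "(i+3,1)"] exI[of _ "(i+3,-1)"] refl)
qed

lemma triphenylene_right:
  assumes "{(i+1,0), (i+3,0), (i,1), (i,-1)} \<subseteq> S"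
  shows "triphenylene S {(i+1,0), (i+3,0), (i,1), (i,-1)}"
proof -
  have "vt (i+3) 0 \<in> hex_edges (i+1, 0) \<inter> hex_edges (i+3, 0)"
    "hz (i+1) 1 \<in> hex_edges (i+1, 0) \<inter> hex_edges (i, 1)"
    "hz (i+1) 0 \<in> hex_edges (i+1, 0) \<inter> hex_edges (i, -1)"
    by (auto simp: hex_edges_eq)
  then have "hex_edges (i+1,0) \<inter> hex_edges (i+3,0) \<noteq> {}" "hex_edges (i+1,0) \<inter> hex_edges (i,1) \<noteq> {}"
    "hex_edges (i+1,0) \<inter> hex_edges (i,-1) \<noteq> {}" by blast+
  moreover have "hex_verts (i+3,0) \<inter> hex_verts (i,1) = {}" "hex_verts (i+3,0) \<inter> hex_verts (i,-1) = {}"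
    "hex_verts (i,1) \<inter> hex_verts (i,-1) = {}" by (simp_all add: hex_verts_eq)
  ultimately show ?thesis using assms unfolding triphenylene_def
    by (intro conjI exI[of _ "(i+1,0)"] exI[of _ "(i+3,0)"] exI[of _ "(i,1)"] exI[of _ "(i,-1)"] refl)
qed

lemma pyrene_hexes_mem:
  assumes "0 \<le> k" "k < int n"
  shows "(4*k, 0) \<in> pyrene_hexes n" "(4*k+2, 0) \<in> pyrene_hexes n"
    "(4*k+1, 1) \<in> pyrene_hexes n" "(4*k+1, -1) \<in> pyrene_hexes n"
  unfolding pyrene_hexes_def using assms by (auto intro!: bexI[of _ "nat k"])

lemma hex_edges_subset_pyrene_edges: "h \<in> pyrene_hexes n \<Longrightarrow> hex_edges h \<subseteq> pyrene_edges n"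
  unfolding pyrene_edges_def by blast

lemma lattice_hex_pyrene_hexes: "h \<in> pyrene_hexes n \<Longrightarrow> lattice_hex h"
  unfolding pyrene_hexes_def lattice_hex_def by auto

lemma not_crossing_hex:
  assumes "lattice_hex h"
  shows "\<not> crossing M (hex_edges h) D" "\<not> crossing M D (hex_edges h)"
  using assms unfolding crossing_def same_side_def by blast+

lemma tri_left_subset:
  assumes "0 \<le> k" "k + 1 < int n"
  shows "set (tri_left (4*k+2)) \<subseteq> pyrene_edges n"
  using assms by (simp add: tri_left_def hz_mem_pyrene_edges vt_mem_pyrene_edges)

lemma tri_right_subset:
  assumes "0 \<le> k" "k + 1 < int n"
  shows "set (tri_right (4*k+1)) \<subseteq> pyrene_edges n"
  using assms by (simp add: tri_right_def hz_mem_pyrene_edges vt_mem_pyrene_edges)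

lemma tri_left_frag:
  assumes "l - 1 = k"
  shows "tri_left (4*k+2) = [hz (4*k+2) 0, hz (4*k+3) 0, hz (4*l) 0, vt (4*l+1) (-1),
    hz (4*l+1) (-1), hz (4*l+2) (-1), vt (4*l+3) (-1), hz (4*l+2) 0, vt (4*l+2) 0, hz (4*l+2) 1,
    vt (4*l+3) 1, hz (4*l+2) 2, hz (4*l+1) 2, vt (4*l+1) 1, hz (4*l) 1, hz (4*k+3) 1, hz (4*k+2) 1,
    vt (4*k+2) 0]"
  using assms by (auto simp: tri_left_def)

lemma tri_right_frag:
  assumes "j + 1 = k"
  shows "tri_right (4*j+1) = [vt (4*j+1) (-1), hz (4*j+1) (-1), hz (4*j+2) (-1), vt (4*j+3) (-1),
    hz (4*j+3) 0, hz (4*k) 0, hz (4*k+1) 0, vt (4*k+2) 0, hz (4*k+1) 1, hz (4*k) 1, hz (4*j+3) 1,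
    vt (4*j+3) 1, hz (4*j+2) 2, hz (4*j+1) 2, vt (4*j+1) 1, hz (4*j+1) 1, vt (4*j+2) 0, hz (4*j+1) 0]"
  using assms by (auto simp: tri_right_def)

section \<open>The shape of a perfect matching\<close>

datatype slot = Top | Bot | Mid

locale pyrene_matching =
  fixes n :: nat and M :: "edge set"
  assumes n: "n \<ge> 1"
    and perfect: "perfect_matching (pyrene_verts n) (pyrene_edges n) M"
begin

lemma M_subset: "M \<subseteq> pyrene_edges n"
  using perfect unfolding perfect_matching_def by blast

lemma match_vertex:
  assumes v: "(x, y) \<in> pyrene_verts n"
  shows "hz x y \<in> M \<or> hz (x-1) y \<in> M \<or> vt x y \<in> M \<or> vt x (y-1) \<in> M"
    and "hz x y \<in> M \<longrightarrow> hz (x-1) y \<notin> M \<and> vt x y \<notin> M \<and> vt x (y-1) \<notin> M"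
    and "hz (x-1) y \<in> M \<longrightarrow> vt x y \<notin> M \<and> vt x (y-1) \<notin> M"
    and "vt x y \<in> M \<longrightarrow> vt x (y-1) \<notin> M"
proof -
  have ex: "\<exists>!e. e \<in> M \<and> (x, y) \<in> e"
    using perfect v unfolding perfect_matching_def by blast
  have mem: "(x, y) \<in> hz x y" "(x, y) \<in> hz (x-1) y" "(x, y) \<in> vt x y" "(x, y) \<in> vt x (y-1)"
    by (simp_all add: hz_def vt_def)
  obtain e where e: "e \<in> M" "(x, y) \<in> e" using ex by blast
  then have "e \<in> pyrene_edges n" using M_subset by blast
  then show "hz x y \<in> M \<or> hz (x-1) y \<in> M \<or> vt x y \<in> M \<or> vt x (y-1) \<in> M"
  proof (cases rule: pyrene_edge_cases)
    case (1 a b)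
    then have "y = b" "x = a \<or> x - 1 = a" using e(2) by (auto simp: hz_def)
    then show ?thesis using 1 e(1) by auto
  next
    case (2 a b)
    then have "x = a" "y = b \<or> y - 1 = b" using e(2) by (auto simp: vt_def)
    then show ?thesis using 2 e(1) by auto
  qed
  have uniq: "e = e'" if "e \<in> M" "e' \<in> M" "(x, y) \<in> e" "(x, y) \<in> e'" for e e'
    using ex that by blast
  show "hz x y \<in> M \<longrightarrow> hz (x-1) y \<notin> M \<and> vt x y \<notin> M \<and> vt x (y-1) \<notin> M"
    using uniq[of "hz x y" "hz (x-1) y"] uniq[of "hz x y" "vt x y"] uniq[of "hz x y" "vt x (y-1)"]
      mem by auto
  show "hz (x-1) y \<in> M \<longrightarrow> vt x y \<notin> M \<and> vt x (y-1) \<notin> M"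
    using uniq[of "hz (x-1) y" "vt x y"] uniq[of "hz (x-1) y" "vt x (y-1)"] mem by auto
  show "vt x y \<in> M \<longrightarrow> vt x (y-1) \<notin> M"
    using uniq[of "vt x y" "vt x (y-1)"] mem by auto
qed

lemma hz_notin_M: "hz x y \<notin> pyrene_edges n \<Longrightarrow> hz x y \<notin> M"
  and vt_notin_M: "vt x y \<notin> pyrene_edges n \<Longrightarrow> vt x y \<notin> M"
  using M_subset by blast+

lemma frag_verts:
  assumes "0 \<le> k" "k < int n" "y \<in> {-1, 0, 1, 2}"
  shows "(4*k+1, y) \<in> pyrene_verts n" "(4*k+2, y) \<in> pyrene_verts n" "(4*k+3, y) \<in> pyrene_verts n"
proof -
  have "hz (4*k+1) y \<in> pyrene_edges n" "hz (4*k+2) y \<in> pyrene_edges n"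
    using assms by (auto simp: hz_mem_pyrene_edges)
  moreover have "(4*k+1, y) \<in> hz (4*k+1) y" "(4*k+2, y) \<in> hz (4*k+2) y" "(4*k+3, y) \<in> hz (4*k+2) y"
    by (simp_all add: hz_def)
  ultimately show "(4*k+1, y) \<in> pyrene_verts n" "(4*k+2, y) \<in> pyrene_verts n" "(4*k+3, y) \<in> pyrene_verts n"
    unfolding pyrene_verts_def by blast+
qed

definition mid :: "int \<Rightarrow> bool" where "mid k \<longleftrightarrow> vt (4*k+2) 0 \<in> M"
definition top_left :: "int \<Rightarrow> bool" where "top_left k \<longleftrightarrow> hz (4*k+1) 2 \<in> M"
definition bot_left :: "int \<Rightarrow> bool" where "bot_left k \<longleftrightarrow> hz (4*k+1) (-1) \<in> M"

lemma frag_top: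
  assumes k: "0 \<le> k" "k < int n"
  shows "hz (4*k+1) 2 \<in> M \<longleftrightarrow> top_left k" "hz (4*k+2) 2 \<in> M \<longleftrightarrow> \<not> top_left k"
    "vt (4*k+1) 1 \<in> M \<longleftrightarrow> \<not> top_left k" "vt (4*k+3) 1 \<in> M \<longleftrightarrow> top_left k"
    "hz (4*k) 1 \<in> M \<longleftrightarrow> mid k \<and> top_left k" "hz (4*k+1) 1 \<in> M \<longleftrightarrow> \<not> mid k \<and> top_left k"
    "hz (4*k+2) 1 \<in> M \<longleftrightarrow> \<not> mid k \<and> \<not> top_left k" "hz (4*k+3) 1 \<in> M \<longleftrightarrow> mid k \<and> \<not> top_left k"
proof -
  note E = hz_mem_pyrene_edges vt_mem_pyrene_edges
  have N: "vt (4*k+1) 2 \<notin> M" "vt (4*k+2) 2 \<notin> M" "vt (4*k+3) 2 \<notin> M" "vt (4*k+2) 1 \<notin> M"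
    "hz (4*k) 2 \<notin> M" "hz (4*k+3) 2 \<notin> M" "vt (4*k+1) 0 \<notin> M" "vt (4*k+3) 0 \<notin> M"
    using k by (auto intro!: hz_notin_M vt_notin_M simp: E)
  note V = frag_verts[OF k, of 2, simplified] frag_verts[OF k, of 1, simplified]
  have pred: "4*k+1-1 = 4*k" "4*k+2-1 = 4*k+1" "4*k+3-1 = 4*k+2"
    "2-1 = (1::int)" "1-1 = (0::int)" "0-1 = (-1::int)" "-1-1 = (-2::int)" by simp_all
  note m = V[THEN match_vertex(1), unfolded pred] V[THEN match_vertex(2), unfolded pred]
    V[THEN match_vertex(3), unfolded pred] V[THEN match_vertex(4), unfolded pred]
  show "hz (4*k+1) 2 \<in> M \<longleftrightarrow> top_left k" by (simp add: top_left_def)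
  show a: "hz (4*k+2) 2 \<in> M \<longleftrightarrow> \<not> top_left k" using m N unfolding top_left_def by blast
  show b: "vt (4*k+1) 1 \<in> M \<longleftrightarrow> \<not> top_left k" "vt (4*k+3) 1 \<in> M \<longleftrightarrow> top_left k"
    using a m N unfolding top_left_def by blast+
  show "hz (4*k) 1 \<in> M \<longleftrightarrow> mid k \<and> top_left k" "hz (4*k+1) 1 \<in> M \<longleftrightarrow> \<not> mid k \<and> top_left k"
    "hz (4*k+2) 1 \<in> M \<longleftrightarrow> \<not> mid k \<and> \<not> top_left k" "hz (4*k+3) 1 \<in> M \<longleftrightarrow> mid k \<and> \<not> top_left k"
    using b m N unfolding mid_def by blast+
qed

lemma frag_bottom:
  assumes k: "0 \<le> k" "k < int n"
  shows "hz (4*k+1) (-1) \<in> M \<longleftrightarrow> bot_left k" "hz (4*k+2) (-1) \<in> M \<longleftrightarrow> \<not> bot_left k"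
    "vt (4*k+1) (-1) \<in> M \<longleftrightarrow> \<not> bot_left k" "vt (4*k+3) (-1) \<in> M \<longleftrightarrow> bot_left k"
    "hz (4*k) 0 \<in> M \<longleftrightarrow> mid k \<and> bot_left k" "hz (4*k+1) 0 \<in> M \<longleftrightarrow> \<not> mid k \<and> bot_left k"
    "hz (4*k+2) 0 \<in> M \<longleftrightarrow> \<not> mid k \<and> \<not> bot_left k" "hz (4*k+3) 0 \<in> M \<longleftrightarrow> mid k \<and> \<not> bot_left k"
proof -
  note E = hz_mem_pyrene_edges vt_mem_pyrene_edges
  have N: "vt (4*k+1) (-2) \<notin> M" "vt (4*k+2) (-2) \<notin> M" "vt (4*k+3) (-2) \<notin> M" "vt (4*k+2) (-1) \<notin> M"
    "hz (4*k) (-1) \<notin> M" "hz (4*k+3) (-1) \<notin> M" "vt (4*k+1) 0 \<notin> M" "vt (4*k+3) 0 \<notin> M"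
    using k by (auto intro!: hz_notin_M vt_notin_M simp: E)
  note V = frag_verts[OF k, of "- 1", simplified] frag_verts[OF k, of 0, simplified]
  have pred: "4*k+1-1 = 4*k" "4*k+2-1 = 4*k+1" "4*k+3-1 = 4*k+2"
    "2-1 = (1::int)" "1-1 = (0::int)" "0-1 = (-1::int)" "-1-1 = (-2::int)" by simp_all
  note m = V[THEN match_vertex(1), unfolded pred] V[THEN match_vertex(2), unfolded pred]
    V[THEN match_vertex(3), unfolded pred] V[THEN match_vertex(4), unfolded pred]
  show "hz (4*k+1) (-1) \<in> M \<longleftrightarrow> bot_left k" by (simp add: bot_left_def)
  show a: "hz (4*k+2) (-1) \<in> M \<longleftrightarrow> \<not> bot_left k" using m N unfolding bot_left_def by blast
  show b: "vt (4*k+1) (-1) \<in> M \<longleftrightarrow> \<not> bot_left k" "vt (4*k+3) (-1) \<in> M \<longleftrightarrow> bot_left k"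
    using a m N unfolding bot_left_def by blast+
  show "hz (4*k) 0 \<in> M \<longleftrightarrow> mid k \<and> bot_left k" "hz (4*k+1) 0 \<in> M \<longleftrightarrow> \<not> mid k \<and> bot_left k"
    "hz (4*k+2) 0 \<in> M \<longleftrightarrow> \<not> mid k \<and> \<not> bot_left k" "hz (4*k+3) 0 \<in> M \<longleftrightarrow> mid k \<and> \<not> bot_left k"
    using b m N unfolding mid_def by blast+
qed

lemma boundary:
  assumes k: "0 \<le> k" "k \<le> int n"
  shows "vt (4*k) 0 \<in> M \<longleftrightarrow> hz (4*k) 1 \<notin> M \<and> hz (4*k-1) 1 \<notin> M"
    "vt (4*k) 0 \<in> M \<longleftrightarrow> hz (4*k) 0 \<notin> M \<and> hz (4*k-1) 0 \<notin> M"
    "hz (4*k) 1 \<in> M \<longrightarrow> hz (4*k-1) 1 \<notin> M" "hz (4*k) 0 \<in> M \<longrightarrow> hz (4*k-1) 0 \<notin> M"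
proof -
  note E = hz_mem_pyrene_edges vt_mem_pyrene_edges
  have "vt (4*k) 0 \<in> pyrene_edges n" using k n by (simp add: E)
  then have V: "(4*k, 0) \<in> pyrene_verts n" "(4*k, 1) \<in> pyrene_verts n"
    unfolding pyrene_verts_def by (auto simp: vt_def)
  have N: "vt (4*k) 1 \<notin> M" "vt (4*k) (-1) \<notin> M" using k by (auto intro!: vt_notin_M simp: E)
  note m = match_vertex[OF V(1), simplified] match_vertex[OF V(2), simplified]
  show "vt (4*k) 0 \<in> M \<longleftrightarrow> hz (4*k) 1 \<notin> M \<and> hz (4*k-1) 1 \<notin> M"
    "vt (4*k) 0 \<in> M \<longleftrightarrow> hz (4*k) 0 \<notin> M \<and> hz (4*k-1) 0 \<notin> M"
    "hz (4*k) 1 \<in> M \<longrightarrow> hz (4*k-1) 1 \<notin> M" "hz (4*k) 0 \<in> M \<longrightarrow> hz (4*k-1) 0 \<notin> M"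
    using m N by blast+
qed

lemma mid_imp_top_left_eq_bot_left:
  assumes "0 \<le> k" "k < int n" "mid k"
  shows "top_left k = bot_left k"
proof -
  have "k < int n \<longrightarrow> mid k \<longrightarrow> top_left k = bot_left k" using \<open>0 \<le> k\<close>
  proof (induction k rule: int_ge_induct)
    case base
    have "hz (-1) 0 \<notin> M" "hz (-1) 1 \<notin> M" by (auto intro!: hz_notin_M simp: hz_mem_pyrene_edges)
    then show ?case using frag_top(5)[of 0] frag_bottom(5)[of 0] boundary(1,2)[of 0] by auto
  next
    case (step i)
    show ?case
    proof (intro impI)
      assume k: "i + 1 < int n" "mid (i + 1)"
      have pred: "4 * (i + 1) - 1 = 4 * i + 3" by simp
      show "top_left (i + 1) = bot_left (i + 1)"
        using step k frag_top(8)[of i] frag_bottom(8)[of i] frag_top(5)[of "i+1"]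
          frag_bottom(5)[of "i+1"] boundary[of "i+1", unfolded pred] by auto
    qed
  qed
  then show ?thesis using assms by blast
qed

text \<open>The matching of an open fragment covers both vertices of its left (resp. right) boundary edge.\<close>

definition left_open :: "int \<Rightarrow> bool" where "left_open k \<longleftrightarrow> 0 \<le> k \<and> k < int n \<and> mid k \<and> top_left k"
definition right_open :: "int \<Rightarrow> bool" where "right_open k \<longleftrightarrow> 0 \<le> k \<and> k < int n \<and> mid k \<and> \<not> top_left k"

lemma vt_boundary:
  assumes k: "0 \<le> k" "k \<le> int n"
  shows "vt (4*k) 0 \<in> M \<longleftrightarrow> \<not> left_open k \<and> \<not> right_open (k-1)" and "\<not> (left_open k \<and> right_open (k-1))"
proof -
  have 1: "hz (4*k) 1 \<in> M \<longleftrightarrow> left_open k"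
  proof (cases "k < int n")
    case True then show ?thesis using k frag_top(5)[of k] by (simp add: left_open_def)
  next
    case False then show ?thesis by (auto intro!: hz_notin_M simp: left_open_def hz_mem_pyrene_edges)
  qed
  have 2: "hz (4*k-1) 1 \<in> M \<longleftrightarrow> right_open (k-1)"
  proof (cases "k = 0")
    case True then show ?thesis by (auto intro!: hz_notin_M simp: right_open_def hz_mem_pyrene_edges)
  next
    case False then show ?thesis using k frag_top(8)[of "k-1"] by (simp add: right_open_def)
  qed
  show "vt (4*k) 0 \<in> M \<longleftrightarrow> \<not> left_open k \<and> \<not> right_open (k-1)" "\<not> (left_open k \<and> right_open (k-1))"
    using boundary(1,3)[OF k] 1 2 by blast+
qed

section \<open>Edges meeting every alternating cycle\<close>

text \<open>One slot per cycle of the set to be constructed: \<open>Top\<close> and \<open>Bot\<close> stand for the outer hexagons, \<open>Mid\<close>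
  for the cycle through the row hexagons.\<close>

definition slots :: "(int \<times> slot) set" where
  "slots = {(k, s). 0 \<le> k \<and> k < int n \<and> (if s = Mid then top_left k = bot_left k else \<not> mid k)}"

fun cut_edge :: "int \<times> slot \<Rightarrow> edge" where
  "cut_edge (k, Top) = (if top_left k then hz (4*k+2) 2 else hz (4*k+1) 2)"
| "cut_edge (k, Bot) = (if bot_left k then hz (4*k+2) (-1) else hz (4*k+1) (-1))"
| "cut_edge (k, Mid) = (if left_open k then vt (4*k) 0 else if right_open k then vt (4*k+4) 0 else vt (4*k+2) 0)"

lemma finite_slots: "finite slots"
proof -
  have "(UNIV :: slot set) = {Top, Bot, Mid}" using slot.exhaust by blast
  then have "finite (UNIV :: slot set)" by (metis finite.emptyI finite_insert)
  then have "finite ({0..<int n} \<times> (UNIV :: slot set))" by (intro finite_cartesian_product) simp_all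
  then show ?thesis by (rule rev_finite_subset) (auto simp: slots_def)
qed

lemma cut_edge_notin_M: "i \<in> slots \<Longrightarrow> cut_edge i \<notin> M"
proof (induction i rule: cut_edge.induct)
  case (1 k)
  then show ?case using frag_top(1,2)[of k] by (auto simp: slots_def)
next
  case (2 k)
  then show ?case using frag_bottom(1,2)[of k] by (auto simp: slots_def)
next
  case (3 k)
  then have k: "0 \<le> k" "k < int n" by (auto simp: slots_def)
  show ?case
    using k vt_boundary(1)[of k] vt_boundary(1)[of "k+1"] by (auto simp: left_open_def right_open_def mid_def)
qed

lemma cut_edge_mem:
  assumes k: "0 \<le> k" "k < int n"
  shows "\<not> mid k \<Longrightarrow> top_left k \<Longrightarrow> hz (4*k+2) 2 \<in> cut_edge ` slots"
    "\<not> mid k \<Longrightarrow> \<not> top_left k \<Longrightarrow> hz (4*k+1) 2 \<in> cut_edge ` slots"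
    "\<not> mid k \<Longrightarrow> bot_left k \<Longrightarrow> hz (4*k+2) (-1) \<in> cut_edge ` slots"
    "\<not> mid k \<Longrightarrow> \<not> bot_left k \<Longrightarrow> hz (4*k+1) (-1) \<in> cut_edge ` slots"
    "\<not> mid k \<Longrightarrow> top_left k = bot_left k \<Longrightarrow> vt (4*k+2) 0 \<in> cut_edge ` slots"
    "left_open k \<Longrightarrow> vt (4*k) 0 \<in> cut_edge ` slots"
    "right_open k \<Longrightarrow> vt (4*k+4) 0 \<in> cut_edge ` slots"
proof -
  have img: "(k, s) \<in> slots \<Longrightarrow> cut_edge (k, s) \<in> cut_edge ` slots" for s by (rule imageI)
  show "\<not> mid k \<Longrightarrow> top_left k \<Longrightarrow> hz (4*k+2) 2 \<in> cut_edge ` slots"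
    "\<not> mid k \<Longrightarrow> \<not> top_left k \<Longrightarrow> hz (4*k+1) 2 \<in> cut_edge ` slots"
    "\<not> mid k \<Longrightarrow> bot_left k \<Longrightarrow> hz (4*k+2) (-1) \<in> cut_edge ` slots"
    "\<not> mid k \<Longrightarrow> \<not> bot_left k \<Longrightarrow> hz (4*k+1) (-1) \<in> cut_edge ` slots"
    "\<not> mid k \<Longrightarrow> top_left k = bot_left k \<Longrightarrow> vt (4*k+2) 0 \<in> cut_edge ` slots"
    "left_open k \<Longrightarrow> vt (4*k) 0 \<in> cut_edge ` slots"
    "right_open k \<Longrightarrow> vt (4*k+4) 0 \<in> cut_edge ` slots"
    using k img[of Top] img[of Bot] img[of Mid] mid_imp_top_left_eq_bot_left[OF k]
    by (simp_all add: slots_def left_open_def right_open_def)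
qed

text \<open>The potentials of the lower and upper vertex of the \<open>k\<close>-th boundary edge form an interval
  \<open>[\<beta> k, \<tau> k]\<close>. Paths through an open fragment force the next interval to be nested in the current
  one or conversely, a skew fragment can be traversed in one direction only and forces
  the intervals to be disjoint and ordered, and a closed fragment forces nothing.\<close>

lemma levels:
  obtains \<beta> \<tau> :: "int \<Rightarrow> int" where
    "\<And>k. 0 \<le> k \<Longrightarrow> k \<le> int n \<Longrightarrow> \<beta> k + 20 \<le> \<tau> k"
    "\<And>k. 0 \<le> k \<Longrightarrow> k < int n \<Longrightarrow> mid k \<Longrightarrow> top_left k \<Longrightarrow> \<beta> k + 10 \<le> \<beta> (k + 1) \<and> \<tau> (k + 1) + 10 \<le> \<tau> k"
    "\<And>k. 0 \<le> k \<Longrightarrow> k < int n \<Longrightarrow> mid k \<Longrightarrow> \<not> top_left k \<Longrightarrow> \<beta> (k + 1) + 10 \<le> \<beta> k \<and> \<tau> k + 10 \<le> \<tau> (k + 1)"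
    "\<And>k. 0 \<le> k \<Longrightarrow> k < int n \<Longrightarrow> \<not> mid k \<Longrightarrow> top_left k \<Longrightarrow> \<not> bot_left k \<Longrightarrow> \<tau> k + 10 \<le> \<beta> (k + 1)"
    "\<And>k. 0 \<le> k \<Longrightarrow> k < int n \<Longrightarrow> \<not> mid k \<Longrightarrow> \<not> top_left k \<Longrightarrow> bot_left k \<Longrightarrow> \<tau> (k + 1) + 10 \<le> \<beta> k"
proof -
  define f :: "int \<Rightarrow> int" where "f k = (if mid k then if top_left k then -1 else 1 else 0)" for k
  define g :: "int \<Rightarrow> int" where
    "g k = (if mid k \<or> top_left k = bot_left k then 0 else if top_left k then 1 else -1)" for k
  define w where "w k = 10 * (int n + 1) + 10 * sum f {0..<k}" for k
  define c where "c k = 50 * (int n + 1) * sum g {0..<k}" for k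
  have step: "sum h {0..<k+1} = sum h {0..<k} + h k" if "0 \<le> k" for k :: int and h :: "int \<Rightarrow> int"
  proof -
    have "{0..<k+1} = insert k {0..<k}" using that by auto
    then show ?thesis by simp
  qed
  have bound: "\<bar>sum f {0..<k}\<bar> \<le> k" if "0 \<le> k" for k
  proof -
    have "\<bar>sum f {0..<k}\<bar> \<le> (\<Sum>j\<in>{0..<k}. \<bar>f j\<bar>)" by (rule sum_abs)
    also have "\<dots> \<le> (\<Sum>j\<in>{0..<k}. 1)" by (rule sum_mono) (simp add: f_def)
    finally show ?thesis using that by simp
  qed
  have w: "10 \<le> w k" "w k \<le> 20 * (int n + 1)" if "0 \<le> k" "k \<le> int n" for k
    using bound[OF that(1)] that unfolding w_def abs_le_iff by auto
  have w_step: "w (k + 1) = w k + 10 * f k" if "0 \<le> k" for k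
    using step[OF that] by (simp add: w_def)
  have c_step: "c (k + 1) = c k + 50 * (int n + 1) * g k" if "0 \<le> k" for k
    using step[OF that] by (simp add: c_def distrib_left)
  show ?thesis
  proof (rule that[of "\<lambda>k. c k - w k" "\<lambda>k. c k + w k"])
    fix k assume k: "0 \<le> k" "k < int n"
    note steps = w_step[OF k(1)] c_step[OF k(1)]
    have k': "0 \<le> k + 1" "k + 1 \<le> int n" "k \<le> int n" using k by simp_all
    note ws = w[OF k(1) k'(3)] w[OF k'(1,2)]
    show "mid k \<Longrightarrow> top_left k \<Longrightarrow>
       c k - w k + 10 \<le> c (k + 1) - w (k + 1) \<and> c (k + 1) + w (k + 1) + 10 \<le> c k + w k"
      using steps by (simp add: f_def g_def)
    show "mid k \<Longrightarrow> \<not> top_left k \<Longrightarrow>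
       c (k + 1) - w (k + 1) + 10 \<le> c k - w k \<and> c k + w k + 10 \<le> c (k + 1) + w (k + 1)"
      using steps by (simp add: f_def g_def)
    show "\<not> mid k \<Longrightarrow> top_left k \<Longrightarrow> \<not> bot_left k \<Longrightarrow> c k + w k + 10 \<le> c (k + 1) - w (k + 1)"
      using steps ws by (simp add: f_def g_def)
    show "\<not> mid k \<Longrightarrow> \<not> top_left k \<Longrightarrow> bot_left k \<Longrightarrow> c (k + 1) + w (k + 1) + 10 \<le> c k - w k"
      using steps ws by (simp add: f_def g_def)
  next
    fix k assume "0 \<le> k" "k \<le> int n"
    then show "c k - w k + 20 \<le> c k + w k" using w(1) by fastforce
  qed
qed

text \<open>Entry \<open>r - 1\<close>, \<open>y + 1\<close> of the tables is the potential of the vertex \<open>(4 k + r, y)\<close>, \<open>r = 1, 2, 3\<close>, of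
  fragment \<open>k\<close>; for the mirror-image shapes \<open>r\<close> is replaced by \<open>4 - r\<close> and the boundary values are
  exchanged.\<close>

definition pot_open :: "int \<Rightarrow> int \<Rightarrow> int \<Rightarrow> int \<Rightarrow> int" where
  "pot_open b t r y = [[b+2, b+1, t-1, t-2], [b+3, b+6, b+7, t-3], [b+4, b+5, t-5, t-4]] ! nat (r-1) ! nat (y+1)"

definition pot_skew :: "int \<Rightarrow> int \<Rightarrow> int \<Rightarrow> int \<Rightarrow> int \<Rightarrow> int \<Rightarrow> int" where
  "pot_skew b t b' t' r y = [[b-2, b-1, t+1, t], [t+6, t+3, t+2, t-1], [t+5, t+4, t'+1, t'+2]] ! nat (r-1) ! nat (y+1)"

definition pot_closed :: "int \<Rightarrow> int \<Rightarrow> int \<Rightarrow> int \<Rightarrow> int \<Rightarrow> int \<Rightarrow> int" where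
  "pot_closed b t b' t' r y = [[b, b-1, t+1, t], [b+1, b-2, t+2, t-1],
     [min b b'-4, min b b'-3, max t t'+3, max t t'+4]] ! nat (r-1) ! nat (y+1)"

definition pot :: "(int \<Rightarrow> int) \<Rightarrow> (int \<Rightarrow> int) \<Rightarrow> int \<times> int \<Rightarrow> int" where
  "pot \<beta> \<tau> v = (let k = fst v div 4; r = fst v mod 4; y = snd v;
      b = \<beta> k; t = \<tau> k; b' = \<beta> (k + 1); t' = \<tau> (k + 1) in
    if r = 0 then (if y \<le> 0 then b else t)
    else if mid k then (if top_left k then pot_open b t r y else pot_open b' t' (4-r) y)
    else if top_left k then (if bot_left k then pot_closed b t b' t' r y else pot_skew b t b' t' r y)
    else (if bot_left k then pot_skew b' t' b t (4-r) y else pot_closed b' t' b t (4-r) y))"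

lemma cut_edges_hit_alternating_cycle:
  assumes C: "alternating_cycle (pyrene_edges n) M C"
  shows "C \<inter> cut_edge ` slots \<noteq> {}"
proof -
  obtain \<beta> \<tau> :: "int \<Rightarrow> int" where lev:
    "\<And>k. 0 \<le> k \<Longrightarrow> k \<le> int n \<Longrightarrow> \<beta> k + 20 \<le> \<tau> k"
    "\<And>k. 0 \<le> k \<Longrightarrow> k < int n \<Longrightarrow> mid k \<Longrightarrow> top_left k \<Longrightarrow> \<beta> k + 10 \<le> \<beta> (k + 1) \<and> \<tau> (k + 1) + 10 \<le> \<tau> k"
    "\<And>k. 0 \<le> k \<Longrightarrow> k < int n \<Longrightarrow> mid k \<Longrightarrow> \<not> top_left k \<Longrightarrow> \<beta> (k + 1) + 10 \<le> \<beta> k \<and> \<tau> k + 10 \<le> \<tau> (k + 1)"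
    "\<And>k. 0 \<le> k \<Longrightarrow> k < int n \<Longrightarrow> \<not> mid k \<Longrightarrow> top_left k \<Longrightarrow> \<not> bot_left k \<Longrightarrow> \<tau> k + 10 \<le> \<beta> (k + 1)"
    "\<And>k. 0 \<le> k \<Longrightarrow> k < int n \<Longrightarrow> \<not> mid k \<Longrightarrow> \<not> top_left k \<Longrightarrow> bot_left k \<Longrightarrow> \<tau> (k + 1) + 10 \<le> \<beta> k"
    by (rule levels) (rule that, assumption+)
  define \<phi> where "\<phi> = pot \<beta> \<tau>"
  have \<phi>0: "\<phi> (4*k, y) = (if y \<le> 0 then \<beta> k else \<tau> k)"
      "\<phi> (4*k+4, y) = (if y \<le> 0 then \<beta> (k+1) else \<tau> (k+1))" for k y
    by (simp_all add: \<phi>_def pot_def Let_def)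
  have \<phi>_frag:
    "\<phi> (4*k+1, y) = (if mid k then (if top_left k then pot_open (\<beta> k) (\<tau> k) 1 y else pot_open (\<beta> (k+1)) (\<tau> (k+1)) 3 y)
        else if top_left k then (if bot_left k then pot_closed (\<beta> k) (\<tau> k) (\<beta> (k+1)) (\<tau> (k+1)) 1 y
          else pot_skew (\<beta> k) (\<tau> k) (\<beta> (k+1)) (\<tau> (k+1)) 1 y)
        else (if bot_left k then pot_skew (\<beta> (k+1)) (\<tau> (k+1)) (\<beta> k) (\<tau> k) 3 y
          else pot_closed (\<beta> (k+1)) (\<tau> (k+1)) (\<beta> k) (\<tau> k) 3 y))"
    "\<phi> (4*k+2, y) = (if mid k then (if top_left k then pot_open (\<beta> k) (\<tau> k) 2 y else pot_open (\<beta> (k+1)) (\<tau> (k+1)) 2 y)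
        else if top_left k then (if bot_left k then pot_closed (\<beta> k) (\<tau> k) (\<beta> (k+1)) (\<tau> (k+1)) 2 y
          else pot_skew (\<beta> k) (\<tau> k) (\<beta> (k+1)) (\<tau> (k+1)) 2 y)
        else (if bot_left k then pot_skew (\<beta> (k+1)) (\<tau> (k+1)) (\<beta> k) (\<tau> k) 2 y
          else pot_closed (\<beta> (k+1)) (\<tau> (k+1)) (\<beta> k) (\<tau> k) 2 y))"
    "\<phi> (4*k+3, y) = (if mid k then (if top_left k then pot_open (\<beta> k) (\<tau> k) 3 y else pot_open (\<beta> (k+1)) (\<tau> (k+1)) 1 y)
        else if top_left k then (if bot_left k then pot_closed (\<beta> k) (\<tau> k) (\<beta> (k+1)) (\<tau> (k+1)) 3 y
          else pot_skew (\<beta> k) (\<tau> k) (\<beta> (k+1)) (\<tau> (k+1)) 3 y)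
        else (if bot_left k then pot_skew (\<beta> (k+1)) (\<tau> (k+1)) (\<beta> k) (\<tau> k) 1 y
          else pot_closed (\<beta> (k+1)) (\<tau> (k+1)) (\<beta> k) (\<tau> k) 1 y))"
    for k y by (simp_all add: \<phi>_def pot_def Let_def)
  have types: thesis
    if k: "0 \<le> k" "k < int n"
      and "\<lbrakk>mid k; top_left k; bot_left k; \<beta> k + 10 \<le> \<beta> (k + 1); \<tau> (k + 1) + 10 \<le> \<tau> k\<rbrakk> \<Longrightarrow> thesis"
      and "\<lbrakk>mid k; \<not> top_left k; \<not> bot_left k; \<beta> (k + 1) + 10 \<le> \<beta> k; \<tau> k + 10 \<le> \<tau> (k + 1)\<rbrakk> \<Longrightarrow> thesis"
      and "\<lbrakk>\<not> mid k; top_left k; \<not> bot_left k; \<tau> k + 10 \<le> \<beta> (k + 1)\<rbrakk> \<Longrightarrow> thesis"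
      and "\<lbrakk>\<not> mid k; \<not> top_left k; bot_left k; \<tau> (k + 1) + 10 \<le> \<beta> k\<rbrakk> \<Longrightarrow> thesis"
      and "\<lbrakk>\<not> mid k; top_left k; bot_left k\<rbrakk> \<Longrightarrow> thesis"
      and "\<lbrakk>\<not> mid k; \<not> top_left k; \<not> bot_left k\<rbrakk> \<Longrightarrow> thesis" for k thesis
    using that(3-8) lev(2-5)[OF k] mid_imp_top_left_eq_bot_left[OF k] by blast
  have succ: "4*k+1+1 = 4*k+2" "4*k+2+1 = 4*k+3" "4*k+3+1 = 4*k+4" for k :: int by simp_all
  note \<phi>_simps = succ \<phi>0 \<phi>_frag pot_open_def pot_skew_def pot_closed_def
  have hz_dir: "if even (x + y) = (hz x y \<in> M) then \<phi> (x, y) < \<phi> (x + 1, y) else \<phi> (x + 1, y) < \<phi> (x, y)"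
    if e: "hz x y \<in> pyrene_edges n" "hz x y \<notin> cut_edge ` slots" for x y
  proof -
    obtain k where x: "x = 4*k \<or> x = 4*k + 1 \<or> x = 4*k + 2 \<or> x = 4*k + 3" using mod_4_cases by blast
    have k: "0 \<le> k" "k < int n" using x e(1) by (auto simp: hz_mem_pyrene_edges)
    have "y = 0 \<or> y = 1 \<or> (y = 2 \<or> y = -1) \<and> (x = 4*k + 1 \<or> x = 4*k + 2)"
      using x e(1) by (auto simp: hz_mem_pyrene_edges)
    with x have "x = 4*k \<and> y = 0 \<or> x = 4*k \<and> y = 1 \<or> x = 4*k + 3 \<and> y = 0 \<or> x = 4*k + 3 \<and> y = 1 \<or>
        x = 4*k + 1 \<and> y = -1 \<or> x = 4*k + 1 \<and> y = 0 \<or> x = 4*k + 1 \<and> y = 1 \<or> x = 4*k + 1 \<and> y = 2 \<or>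
        x = 4*k + 2 \<and> y = -1 \<or> x = 4*k + 2 \<and> y = 0 \<or> x = 4*k + 2 \<and> y = 1 \<or> x = 4*k + 2 \<and> y = 2"
      by (elim disjE conjE) simp_all
    moreover have "\<beta> k + 20 \<le> \<tau> k" "\<beta> (k + 1) + 20 \<le> \<tau> (k + 1)" using lev(1) k by simp_all
    ultimately show ?thesis using e(2)
      by - (elim disjE conjE; hypsubst; rule types[OF k];
          (simp add: \<phi>_simps frag_top[OF k] frag_bottom[OF k] cut_edge_mem[OF k]))
  qed
  have vt_dir: "if vt x y \<in> M then \<phi> (x, y) < \<phi> (x, y + 1) else \<phi> (x, y + 1) < \<phi> (x, y)"
    if e: "vt x y \<in> pyrene_edges n" "vt x y \<notin> cut_edge ` slots" for x y
  proof -
    obtain k where x: "x = 4*k \<or> x = 4*k + 1 \<or> x = 4*k + 2 \<or> x = 4*k + 3" using mod_4_cases by blast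
    have k: "0 \<le> k" "k \<le> int n" using x e(1) by (auto simp: vt_mem_pyrene_edges)
    show ?thesis
    proof (cases "x = 4*k")
      case True
      have "y = 0" using e(1) True by (auto simp: vt_mem_pyrene_edges)
      moreover have "vt (4*k) 0 \<in> M"
        using cut_edge_mem(6)[of k] cut_edge_mem(7)[of "k-1"] vt_boundary(1)[OF k] e(2) True \<open>y = 0\<close>
        by (auto simp: left_open_def right_open_def)
      ultimately show ?thesis using True lev(1)[OF k] by (simp add: \<phi>0)
    next
      case False
      have k': "k < int n" using x e(1) False k by (auto simp: vt_mem_pyrene_edges)
      have "x = 4*k + 2 \<and> y = 0 \<or> x = 4*k + 1 \<and> y = 1 \<or> x = 4*k + 1 \<and> y = -1 \<or>
          x = 4*k + 3 \<and> y = 1 \<or> x = 4*k + 3 \<and> y = -1"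
        using x e(1) False by (auto simp: vt_mem_pyrene_edges)
      moreover have "\<beta> k + 20 \<le> \<tau> k" "\<beta> (k + 1) + 20 \<le> \<tau> (k + 1)" using lev(1) k k' by simp_all
      ultimately show ?thesis using e(2)
        by - (elim disjE conjE; hypsubst; rule types[OF k(1) k'];
            simp add: \<phi>_simps mid_def[symmetric] frag_top[OF k(1) k'] frag_bottom[OF k(1) k'] cut_edge_mem[OF k(1) k'])
    qed
  qed
  have vt_even: "even (x + y)" if "vt x y \<in> pyrene_edges n" for x y
    using that by (auto simp: vt_mem_pyrene_edges) presburger+
  show ?thesis
  proof (rule alternating_cycle_hits_if_potential[OF C, where \<phi> = \<phi> and black = "\<lambda>v. even (fst v + snd v)"])
    fix v e assume e: "e \<in> pyrene_edges n" "e \<in> M" and v: "v \<in> e" "even (fst v + snd v)"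
    have cut: "e \<notin> cut_edge ` slots" using cut_edge_notin_M e by blast
    show "\<exists>w\<in>e. \<phi> v < \<phi> w" using e(1)
    proof (cases rule: pyrene_edge_cases)
      case (1 x y)
      then show ?thesis using v hz_dir[of x y] e cut by (auto simp: hz_def split: if_splits)
    next
      case (2 x y)
      then show ?thesis using v vt_dir[of x y] vt_even[of x y] e cut by (auto simp: vt_def split: if_splits)
    qed
  next
    fix v e assume e: "e \<in> pyrene_edges n" "e \<notin> M" "e \<notin> cut_edge ` slots" and v: "v \<in> e" "odd (fst v + snd v)"
    show "\<exists>w\<in>e. \<phi> v < \<phi> w" using e(1)
    proof (cases rule: pyrene_edge_cases)
      case (1 x y)
      then show ?thesis using v hz_dir[of x y] e by (auto simp: hz_def split: if_splits)
    next
      case (2 x y)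
      then show ?thesis using v vt_dir[of x y] vt_even[of x y] e by (auto simp: vt_def split: if_splits)
    qed
  qed
qed

section \<open>A compatible set of hexagons and triphenylenes\<close>

fun slot_cycle :: "int \<times> slot \<Rightarrow> edge set" where
  "slot_cycle (k, Top) = hex_edges (4*k+1, 1)"
| "slot_cycle (k, Bot) = hex_edges (4*k+1, -1)"
| "slot_cycle (k, Mid) =
    (if top_left k then (if right_open (k-1) then set (tri_right (4*(k-1)+1)) else hex_edges (4*k, 0))
     else (if left_open (k+1) then set (tri_left (4*k+2)) else hex_edges (4*k+2, 0)))"

lemma frag_mid: "vt (4*k+2) 0 \<in> M \<longleftrightarrow> mid k"
  by (simp add: mid_def)

lemma hex_walk_frag:
  "hex_walk (4*k+1) 1 = [hz (4*k+1) 1, hz (4*k+2) 1, vt (4*k+3) 1, hz (4*k+2) 2, hz (4*k+1) 2, vt (4*k+1) 1]"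
  "hex_walk (4*k+1) (-1) = [hz (4*k+1) (-1), hz (4*k+2) (-1), vt (4*k+3) (-1), hz (4*k+2) 0, hz (4*k+1) 0, vt (4*k+1) (-1)]"
  "hex_walk (4*k) 0 = [hz (4*k) 0, hz (4*k+1) 0, vt (4*k+2) 0, hz (4*k+1) 1, hz (4*k) 1, vt (4*k) 0]"
  "hex_walk (4*k+2) 0 = [hz (4*k+2) 0, hz (4*k+3) 0, vt (4*k+4) 0, hz (4*k+3) 1, hz (4*k+2) 1, vt (4*k+2) 0]"
  by (simp_all add: hex_walk_def)

text \<open>Compatibility is shown by assigning to every edge outside \<open>M\<close> the only slot whose cycle may contain
  it. The edges of an open fragment may lie on the triphenylene that belongs to the fragment it opens
  to, which is \<open>nbr\<close>.\<close>

definition nbr :: "int \<Rightarrow> int \<times> slot" where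
  "nbr k = (if mid k then if top_left k then k - 1 else k + 1 else k, Mid)"

definition own_hz :: "int \<Rightarrow> int \<Rightarrow> int \<times> slot" where
  "own_hz x y = (let k = x div 4; r = x mod 4; s = (if y \<ge> 1 then Top else Bot) in
    if y = 0 \<or> y = 1 then
      if r = 0 \<or> r = 3 \<or> mid k \<and> (r = 1) = top_left k then (k, Mid)
      else if mid k then nbr k else (k, s)
    else if mid k then nbr k else (k, s))"

definition own_vt :: "int \<Rightarrow> int \<Rightarrow> int \<times> slot" where
  "own_vt x y = (let k = x div 4; r = x mod 4 in
    if y = 0 then (if r = 2 \<or> left_open k then k else k - 1, Mid)
    else if mid k then nbr k else (k, if y = 1 then Top else Bot))"

definition owned :: "int \<times> slot \<Rightarrow> edge \<Rightarrow> bool" where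
  "owned i e \<longleftrightarrow> (\<exists>x y. e = hz x y \<and> own_hz x y = i \<or> e = vt x y \<and> own_vt x y = i)"

lemma owned_simps:
  "owned i (hz x y) \<longleftrightarrow> own_hz x y = i" "owned i (vt x y) \<longleftrightarrow> own_vt x y = i"
  by (auto simp: owned_def)

lemma owned_unique: "owned i e \<Longrightarrow> owned j e \<Longrightarrow> i = j"
  by (auto simp: owned_def)

definition tri_owned :: "int \<times> slot \<Rightarrow> edge \<Rightarrow> bool" where
  "tri_owned i e \<longleftrightarrow> (\<exists>x y. (e = hz x y \<or> e = vt x y) \<and> nbr (x div 4) = i)"

lemma tri_owned_simps:
  "tri_owned i (hz x y) \<longleftrightarrow> nbr (x div 4) = i" "tri_owned i (vt x y) \<longleftrightarrow> nbr (x div 4) = i"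
  by (auto simp: tri_owned_def)

lemma tri_owned_unique: "tri_owned i e \<Longrightarrow> tri_owned j e \<Longrightarrow> i = j"
  by (auto simp: tri_owned_def)

definition good_cycle :: "int \<times> slot \<Rightarrow> edge set \<Rightarrow> bool" where
  "good_cycle i C \<longleftrightarrow> alternating_cycle (pyrene_edges n) M C \<and> (\<forall>e\<in>C. e \<in> M \<or> owned i e) \<and>
     ((\<exists>h\<in>pyrene_hexes n. C = hex_edges h) \<or>
      (\<exists>T. triphenylene (pyrene_hexes n) T \<and> C = periphery T) \<and> (\<forall>e\<in>C. tri_owned i e))"

lemma good_cycle_hex:
  assumes "(a, b) \<in> pyrene_hexes n" "alternates M (hex_walk a b)"
    and "\<forall>e\<in>set (hex_walk a b). e \<in> M \<or> owned i e"
  shows "good_cycle i (hex_edges (a, b))"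
  using assms alternating_cycle_hex[OF hex_edges_subset_pyrene_edges]
  unfolding good_cycle_def set_hex_walk by blast

lemma good_slot_cycle:
  assumes "i \<in> slots"
  shows "good_cycle i (slot_cycle i)"
proof (cases i)
  case (Pair k s)
  have k: "0 \<le> k" "k < int n" using assms Pair by (auto simp: slots_def)
  note tab = frag_top[OF k] frag_bottom[OF k] frag_mid
  note own = owned_simps own_hz_def own_vt_def nbr_def Let_def
  show ?thesis
  proof (cases s)
    case Top
    then have "\<not> mid k" using assms Pair by (auto simp: slots_def)
    then have "good_cycle (k, Top) (hex_edges (4*k+1, 1))"
      using k by (intro good_cycle_hex pyrene_hexes_mem) (auto simp: hex_walk_frag tab own)
    then show ?thesis using Pair Top by simp
  next
    case Bot
    then have "\<not> mid k" using assms Pair by (auto simp: slots_def)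
    then have "good_cycle (k, Bot) (hex_edges (4*k+1, -1))"
      using k by (intro good_cycle_hex pyrene_hexes_mem) (auto simp: hex_walk_frag tab own)
    then show ?thesis using Pair Bot by simp
  next
    case Mid
    then have tb: "top_left k = bot_left k" using assms Pair by (auto simp: slots_def)
    have i: "i = (k, Mid)" using Pair Mid by simp
    show ?thesis
    proof (cases "top_left k")
      case True
      show ?thesis
      proof (cases "right_open (k-1)")
        case False
        have "vt (4*k) 0 \<in> M \<longleftrightarrow> \<not> left_open k" using vt_boundary(1)[of k] k False by simp
        then have "good_cycle (k, Mid) (hex_edges (4*k, 0))"
          using k True tb
          by (intro good_cycle_hex pyrene_hexes_mem) (auto simp: hex_walk_frag tab own left_open_def)
        then show ?thesis using i True False by simp
      next
        case right_open: True
        obtain j where j: "j + 1 = k" by (metis diff_add_cancel)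
        then have ltj: "right_open j" using right_open by auto
        then have j': "0 \<le> j" "j < int n" "mid j" "\<not> top_left j" by (auto simp: right_open_def)
        have bj: "\<not> bot_left j" using mid_imp_top_left_eq_bot_left j' by blast
        have mk: "\<not> mid k" using vt_boundary(2)[of k] right_open k True by (auto simp: left_open_def)
        note tabj = frag_top[OF j'(1,2)] frag_bottom[OF j'(1,2)]
        have eq: "4*j+1+1 = 4*j+2" "4*j+1+3 = 4*k" using j by auto
        have "alternating_cycle (pyrene_edges n) M (set (tri_right (4*j+1)))"
          using k j' j by (intro alternating_cycle_tri_right tri_right_subset)
            (auto simp: tri_right_frag[OF j] tab tabj True mk tb[symmetric] bj)
        moreover have "\<forall>e\<in>set (tri_right (4*j+1)). (e \<in> M \<or> owned i e) \<and> tri_owned i e"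
          by (simp add: tri_right_frag[OF j] tab tabj True mk tb[symmetric] bj j j' own i tri_owned_simps)
        moreover have "triphenylene (pyrene_hexes n) {(4*j+1+1,0), (4*j+1+3,0), (4*j+1,1), (4*j+1,-1)}"
          using pyrene_hexes_mem[OF k] pyrene_hexes_mem[OF j'(1,2)] eq
          by (intro triphenylene_right) (simp only: insert_subset empty_subsetI simp_thms)
        ultimately have "good_cycle i (set (tri_right (4*j+1)))"
          unfolding good_cycle_def using periphery_tri_right[symmetric] by blast
        moreover have "k - 1 = j" using j by simp
        ultimately show ?thesis using i True right_open by simp
      qed
    next
      case False
      show ?thesis
      proof (cases "left_open (k+1)")
        case nrt: False
        have "vt (4*k+4) 0 \<in> M \<longleftrightarrow> \<not> right_open k" using vt_boundary(1)[of "k+1"] k nrt by simp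
        then have "good_cycle (k, Mid) (hex_edges (4*k+2, 0))"
          using k False tb nrt
          by (intro good_cycle_hex pyrene_hexes_mem) (auto simp: hex_walk_frag tab own right_open_def)
        then show ?thesis using i False nrt by simp
      next
        case left_open: True
        obtain l where l: "l - 1 = k" by (metis add_diff_cancel_right')
        then have kl: "k + 1 = l" by simp
        then have rtl: "left_open l" using left_open by auto
        then have l': "0 \<le> l" "l < int n" "mid l" "top_left l" by (auto simp: left_open_def)
        have bl: "bot_left l" using mid_imp_top_left_eq_bot_left l' by blast
        have mk: "\<not> mid k" using vt_boundary(2)[of l] rtl l' l k False by (auto simp: right_open_def)
        note tabl = frag_top[OF l'(1,2)] frag_bottom[OF l'(1,2)]
        have eq: "4*k+2+2 = 4*l" "4*k+2+3 = 4*l+1" using l by auto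
        have "alternating_cycle (pyrene_edges n) M (set (tri_left (4*k+2)))"
          using k l' kl by (intro alternating_cycle_tri_left tri_left_subset)
            (auto simp: tri_left_frag[OF l] tab tabl False mk tb[symmetric] bl)
        moreover have "\<forall>e\<in>set (tri_left (4*k+2)). (e \<in> M \<or> owned i e) \<and> tri_owned i e"
          by (simp add: tri_left_frag[OF l] tab tabl False mk tb[symmetric] bl l l' own i tri_owned_simps)
        moreover have "triphenylene (pyrene_hexes n) {(4*k+2+2,0), (4*k+2,0), (4*k+2+3,1), (4*k+2+3,-1)}"
          using pyrene_hexes_mem[OF k] pyrene_hexes_mem[OF l'(1,2)] eq
          by (intro triphenylene_left) (simp only: insert_subset empty_subsetI simp_thms)
        ultimately have "good_cycle i (set (tri_left (4*k+2)))"
          unfolding good_cycle_def using periphery_tri_left[symmetric] by blast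
        then show ?thesis using i False left_open by simp
      qed
    qed
  qed
qed

lemma slot_cycle_Int_subset:
  assumes "i \<in> slots" "j \<in> slots" "i \<noteq> j"
  shows "slot_cycle i \<inter> slot_cycle j \<subseteq> M"
  using good_slot_cycle[OF assms(1)] good_slot_cycle[OF assms(2)] owned_unique assms(3)
  unfolding good_cycle_def by blast

lemma alternating_slot_cycle: "i \<in> slots \<Longrightarrow> alternating_cycle (pyrene_edges n) M (slot_cycle i)"
  using good_slot_cycle unfolding good_cycle_def by blast

lemma inj_on_slot_cycle: "inj_on slot_cycle slots"
proof (rule inj_onI, rule ccontr)
  fix i j assume ij: "i \<in> slots" "j \<in> slots" "slot_cycle i = slot_cycle j" "i \<noteq> j"
  then have "slot_cycle i \<subseteq> M" using slot_cycle_Int_subset[of i j] by simp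
  then show False
    using cut_edges_hit_alternating_cycle[OF alternating_slot_cycle[OF ij(1)]] cut_edge_notin_M by blast
qed

lemma compatible_slot_cycles: "compatible_alt_set (pyrene_edges n) M (slot_cycle ` slots)"
  unfolding compatible_alt_set_def
proof (intro conjI ballI impI)
  fix C assume "C \<in> slot_cycle ` slots"
  then show "alternating_cycle (pyrene_edges n) M C" using alternating_slot_cycle by blast
next
  fix C D assume "C \<in> slot_cycle ` slots" "D \<in> slot_cycle ` slots" "C \<noteq> D"
  then show "compatible_pair M C D"
    using compatible_pair_if_Int_subset[OF perfect[unfolded pyrene_verts_def]] alternating_slot_cycle slot_cycle_Int_subset
    by blast
qed

lemma non_crossing_slot_cycles: "non_crossing M (slot_cycle ` slots)"
  unfolding non_crossing_def
proof (intro ballI impI notI)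
  fix C D assume "C \<in> slot_cycle ` slots" "D \<in> slot_cycle ` slots" "C \<noteq> D" and cr: "crossing M C D"
  then obtain i j where ij: "i \<in> slots" "j \<in> slots" "C = slot_cycle i" "D = slot_cycle j" "i \<noteq> j" by blast
  have "\<nexists>h. h \<in> pyrene_hexes n \<and> C = hex_edges h" "\<nexists>h. h \<in> pyrene_hexes n \<and> D = hex_edges h"
    using cr not_crossing_hex lattice_hex_pyrene_hexes by blast+
  then have "\<forall>e\<in>C. tri_owned i e" "\<forall>e\<in>D. tri_owned j e"
    using good_slot_cycle ij unfolding good_cycle_def by blast+
  then have "C \<inter> D = {}" using tri_owned_unique ij(5) by blast
  then show False using cr unfolding crossing_def by blast
qed

lemma c_prime_eq: "c_prime (pyrene_edges n) M = card (slot_cycle ` slots)"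
proof (rule c_prime_eq_card_if_hitting_set[OF compatible_slot_cycles])
  show "finite (cut_edge ` slots)" using finite_slots by simp
  show "cut_edge ` slots \<inter> M = {}" using cut_edge_notin_M by blast
  show "card (cut_edge ` slots) \<le> card (slot_cycle ` slots)"
    using card_image_le[OF finite_slots] by (simp add: card_image[OF inj_on_slot_cycle])
qed (rule cut_edges_hit_alternating_cycle)

end

theorem lemma2p6:
  fixes n :: nat and M :: "edge set"
  assumes "n \<ge> 1"
    and "perfect_matching (pyrene_verts n) (pyrene_edges n) M"
  shows "\<exists>\<A>. finite \<A> \<and> compatible_alt_set (pyrene_edges n) M \<A> \<and>
           non_crossing M \<A> \<and>
           card \<A> = c_prime (pyrene_edges n) M \<and>
           (\<forall>C\<in>\<A>. (\<exists>h\<in>pyrene_hexes n. C = hex_edges h) \<or>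
                    (\<exists>T. triphenylene (pyrene_hexes n) T \<and> C = periphery T))"
proof -
  interpret pyrene_matching n M using assms by unfold_locales
  have "(\<exists>h\<in>pyrene_hexes n. C = hex_edges h) \<or> (\<exists>T. triphenylene (pyrene_hexes n) T \<and> C = periphery T)"
    if "C \<in> slot_cycle ` slots" for C
    using that good_slot_cycle unfolding good_cycle_def by blast
  then show ?thesis
    using finite_slots compatible_slot_cycles non_crossing_slot_cycles c_prime_eq
    by (intro exI[of _ "slot_cycle ` slots"]) auto
qed

end
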